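(* Let $0<\sigma<1$ and $v\in\mathbb{R}$. The function $x:\mathbb{R}\to\mathbb{C}\cong\mathbb{R}^2$ given by $x(s)=e^{2\pi i s}$ is a solution of the equation $$v^2\ddot x(s)=-\lim_{\delta\to0^+}\int_{s+\delta}^{1+s-\delta}\sigma\,\frac{x(s)-x(r)}{|x(s)-x(r)|^{2+\sigma}}\,dr,\qquad s\in\mathbb{R},$$ if and only if $$v^2=\frac{\sigma}{4\pi^2}\lim_{\delta\to0^+}\int_\delta^{1-\delta}\frac{1-e^{2\pi i t}}{|1-e^{2\pi i t}|^{2+\sigma}}\,dt=\frac{\sigma}{8\pi^2}\int_0^1\frac{dt}{(2\sin(\pi t))^\sigma}.$$
   Context: The plane $\mathbb{R}^2$ is identified with $\mathbb{C}$, with the Euclidean norm equal to the complex modulus. *)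

theory Defs
  imports "HOL-Analysis.Analysis"
begin

text \<open>
  Integrability on every nondegenerate truncated interval is demanded explicitly, since
  \<open>set_lebesgue_integral\<close> is 0 on non-integrable functions.
\<close>

definition has_truncated_integral ::
    "(real \<Rightarrow> complex) \<Rightarrow> real \<Rightarrow> real \<Rightarrow> complex \<Rightarrow> bool" where
  "has_truncated_integral f a b L \<longleftrightarrow>
     (\<forall>\<delta>>0. a + \<delta> < b - \<delta> \<longrightarrow> set_integrable lborel {a + \<delta>..b - \<delta>} f) \<and>
     ((\<lambda>\<delta>. LINT r:{a + \<delta>..b - \<delta>}|lborel. f r) \<longlongrightarrow> L) (at_right 0)"

text \<open>
  The integral in the equation is singular at both ends of \<open>[s, 1 + s]\<close> for a 1-periodic curve.
  For a curve with self-intersections the integrand is 0 (division by zero) where \<open>x r = x s\<close>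
  strictly inside; this does not occur for the unit circle.
\<close>

definition is_solution :: "real \<Rightarrow> real \<Rightarrow> (real \<Rightarrow> complex) \<Rightarrow> bool" where
  "is_solution \<sigma> v x \<longleftrightarrow>
     (\<exists>x1 x2. (\<forall>s. (x has_vector_derivative x1 s) (at s)) \<and>
              (\<forall>s. (x1 has_vector_derivative x2 s) (at s)) \<and>
              (\<forall>s. \<exists>L. has_truncated_integral
                         (\<lambda>r. of_real \<sigma> * ((x s - x r) / of_real (cmod (x s - x r) powr (2 + \<sigma>))))
                         s (1 + s) L \<and>
                       of_real (v\<^sup>2) * x2 s = - L))"

end

theory Submission
  imports Defs
begin

text \<open>
  Writing \<open>e t = exp (2 \<pi> \<i> t)\<close>, one has \<open>e s - e r = e s * (1 - e (r - s))\<close>, so the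
  equation at any \<open>s\<close> is the equation at \<open>0\<close> multiplied by \<open>e s\<close>. At \<open>0\<close> the substitution
  \<open>t \<mapsto> 1 - t\<close> averages the kernel with its conjugate, and
  \<open>2 * Re (1 - e t) = \<bar>1 - e t\<bar>\<^sup>2\<close> lowers the order of the singularity from \<open>1 + \<sigma>\<close>
  to \<open>\<sigma> < 1\<close>, which is integrable.
\<close>

section \<open>Truncated integrals under translation and reflection\<close>

lemma has_truncated_integral_unique:
  assumes "has_truncated_integral f a b L" "has_truncated_integral f a b M"
  shows "L = M"
  using assms tendsto_unique[of "at_right (0::real)"]
  unfolding has_truncated_integral_def by auto

lemma set_integrable_shift:
  fixes f :: "real \<Rightarrow> 'a::{banach, second_countable_topology}"
  shows "set_integrable lborel {a + s..b + s} (\<lambda>r. f (r - s)) = set_integrable lborel {a..b} f"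
proof -
  have "(\<lambda>x. indicator {a + s..b + s} (s + 1 * x) *\<^sub>R f (s + 1 * x - s)) =
        (\<lambda>x. indicator {a..b} x *\<^sub>R f x)"
    by (auto simp: indicator_def)
  then show ?thesis
    unfolding set_integrable_def
    using lborel_integrable_real_affine_iff
        [of 1 "\<lambda>r. indicator {a + s..b + s} r *\<^sub>R f (r - s)" s] by simp
qed

lemma set_integral_shift:
  fixes f :: "real \<Rightarrow> 'a::{banach, second_countable_topology}"
  shows "(LINT r:{a + s..b + s}|lborel. f (r - s)) = (LINT t:{a..b}|lborel. f t)"
proof -
  have "(\<lambda>x. indicator {a + s..b + s} (s + 1 * x) *\<^sub>R f (s + 1 * x - s)) =
        (\<lambda>x. indicator {a..b} x *\<^sub>R f x)"
    by (auto simp: indicator_def)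
  then show ?thesis
    unfolding set_lebesgue_integral_def
    using lborel_integral_real_affine
        [of 1 "\<lambda>r. indicator {a + s..b + s} r *\<^sub>R f (r - s)" s] by simp
qed

text \<open>The truncation points move along with the interval, so each truncated integral is
  translated exactly. The factor \<open>c\<close> is there for
  \<open>of_real \<sigma> * unit_circle s\<close>, which carries the equation from 0 to
  \<open>s\<close>.\<close>

lemma has_truncated_integral_shift:
  assumes "has_truncated_integral f a b L"
  shows "has_truncated_integral (\<lambda>r. c * f (r - s)) (a + s) (b + s) (c * L)"
  unfolding has_truncated_integral_def
proof (intro conjI allI impI)
  have shift: "{a + s + \<delta>..b + s - \<delta>} = {(a + \<delta>) + s..(b - \<delta>) + s}" for \<delta>
    by (simp add: algebra_simps)
  show "set_integrable lborel {a + s + \<delta>..b + s - \<delta>} (\<lambda>r. c * f (r - s))"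
    if "\<delta> > 0" "a + s + \<delta> < b + s - \<delta>" for \<delta>
    unfolding shift
    using assms that by (intro set_integrable_mult_right) 
      (simp add: set_integrable_shift has_truncated_integral_def)
  show "((\<lambda>\<delta>. LINT r:{a + s + \<delta>..b + s - \<delta>}|lborel. c * f (r - s)) \<longlongrightarrow> c * L) (at_right 0)"
    unfolding shift set_integral_mult_right set_integral_shift
    using assms by (intro tendsto_mult_left) (simp add: has_truncated_integral_def)
qed

text \<open>The interval is symmetric about 1/2, hence invariant under the substitution of slope
  -1.\<close>

lemma set_integral_reflect_unit:
  fixes f :: "real \<Rightarrow> 'a::{banach, second_countable_topology}"
  shows "(LINT t:{a..1 - a}|lborel. f (1 - t)) = (LINT t:{a..1 - a}|lborel. f t)"
proof -
  have "(\<lambda>x. indicator {a..1 - a} (1 + (-1) * x) *\<^sub>R f (1 + (-1) * x)) =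
        (\<lambda>x. indicator {a..1 - a} x *\<^sub>R f (1 - x))"
    by (intro ext arg_cong2[where f = scaleR]) (auto simp: indicator_def)
  then show ?thesis
    unfolding set_lebesgue_integral_def
    using lborel_integral_real_affine[of "-1" "\<lambda>r. indicator {a..1 - a} r *\<^sub>R f r" 1] by simp
qed

lemma set_integrable_reflect_unit:
  fixes f :: "real \<Rightarrow> 'a::{banach, second_countable_topology}"
  shows "set_integrable lborel {a..1 - a} (\<lambda>t. f (1 - t)) = set_integrable lborel {a..1 - a} f"
proof -
  have "(\<lambda>x. indicator {a..1 - a} (1 + (-1) * x) *\<^sub>R f (1 + (-1) * x)) =
        (\<lambda>x. indicator {a..1 - a} x *\<^sub>R f (1 - x))"
    by (intro ext arg_cong2[where f = scaleR]) (auto simp: indicator_def)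
  then show ?thesis
    unfolding set_integrable_def
    using lborel_integrable_real_affine_iff[of "-1" "\<lambda>r. indicator {a..1 - a} r *\<^sub>R f r" 1] by simp
qed

section \<open>Integrability of the reduced kernel\<close>

text \<open>Jordan's inequality: sine is concave on \<open>{0..pi}\<close> and so lies above its
  chord from 0 to \<open>pi / 2\<close>.\<close>

lemma sin_pi_ge:
  assumes "0 \<le> t" "t \<le> 1 / 2"
  shows "2 * t \<le> sin (pi * t)"
proof -
  have "convex_on {0..pi} (\<lambda>x. - sin x)"
    by (rule f''_ge0_imp_convex[where f' = "\<lambda>x. - cos x" and f'' = sin])
       (auto intro!: derivative_eq_intros sin_ge_zero)
  \<comment> \<open>The point \<open>pi * t\<close> divides the segment from 0 to
    \<open>pi / 2\<close> with weight \<open>2 * t\<close>.\<close>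
  from convex_onD[OF this, of "2 * t" 0 "pi / 2"] assms show ?thesis
    by (simp add: mult.commute)
qed

lemma sin_pi_reflect: "sin (pi * (1 - t)) = sin (pi * t)"
  by (simp add: right_diff_distrib sin_diff)

lemma set_integrable_powr_minus_unit:
  assumes "\<sigma> < 1"
  shows "set_integrable lborel {0..1} (\<lambda>t::real. t powr - \<sigma>)"
proof -
  have "(\<lambda>t::real. t powr - \<sigma>) integrable_on {0..1}"
    using has_integral_powr_from_0[of "- \<sigma>" 1] assms by auto
  then have "(\<lambda>t::real. t powr - \<sigma>) absolutely_integrable_on {0..1}"
    by (rule nonnegative_absolutely_integrable_1) simp
  \<comment> \<open>Absolute integrability refers to the completed measure; Borel measurability
    brings it back to \<open>lborel\<close>.\<close>
  then show ?thesis
    unfolding set_integrable_def by (subst (asm) integrable_completion) auto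
qed

text \<open>Each half of the interval has one singular endpoint, where Jordan's inequality gives a
  power bound. The sum of the two powers dominates on the whole interval.\<close>

lemma set_integrable_inverse_sin_powr:
  assumes "0 < \<sigma>" "\<sigma> < 1"
  shows "set_integrable lborel {0..1} (\<lambda>t. 1 / (2 * sin (pi * t)) powr \<sigma>)"
proof (rule set_integrable_bound)
  have "set_integrable lborel {0..1} (\<lambda>t::real. (1 - t) powr - \<sigma>)"
    using set_integrable_reflect_unit[of 0 "\<lambda>t. t powr - \<sigma>"]
      set_integrable_powr_minus_unit[OF assms(2)] by simp
  with set_integrable_powr_minus_unit[OF assms(2)]
  show "set_integrable lborel {0..1} (\<lambda>t::real. t powr - \<sigma> + (1 - t) powr - \<sigma>)"
    by (intro set_integral_add)
  show "set_borel_measurable lborel {0..1} (\<lambda>t. 1 / (2 * sin (pi * t)) powr \<sigma>)"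
    unfolding set_borel_measurable_def by measurable
  have half: "1 / (2 * sin (pi * t)) powr \<sigma> \<le> t powr - \<sigma>" if "0 \<le> t" "t \<le> 1 / 2" for t
  \<comment> \<open>At 0 both sides are 0, by the conventions for division by zero and for
    \<open>powr\<close> with base 0.\<close>
  proof (cases "t = 0")
    case False
    have "t powr \<sigma> \<le> (2 * sin (pi * t)) powr \<sigma>"
      using sin_pi_ge[OF that] that assms by (intro powr_mono2) auto
    then show ?thesis
      using that False by (simp add: powr_minus_divide frac_le)
  qed simp
  have "1 / (2 * sin (pi * t)) powr \<sigma> \<le> t powr - \<sigma> + (1 - t) powr - \<sigma>"
    if "0 \<le> t" "t \<le> 1" for t
  proof (cases "t \<le> 1 / 2")
    case True
    show ?thesis
      using half[OF that(1) True] by (simp add: add_increasing2)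
  next
    case False
    then show ?thesis
      using half[of "1 - t"] that by (simp add: sin_pi_reflect add_increasing)
  qed
  then show "AE t\<in>{0..1} in lborel. norm (1 / (2 * sin (pi * t)) powr \<sigma>)
      \<le> norm (t powr - \<sigma> + (1 - t) powr - \<sigma>)"
    by (intro AE_I2) auto
qed

text \<open>The truncated integral is a difference of values of the indefinite integral
  \<open>F\<close>, which is continuous up to both endpoints.\<close>

lemma set_integral_truncated_tendsto:
  fixes g :: "real \<Rightarrow> real"
  assumes g: "set_integrable lborel {0..1} g"
  shows "((\<lambda>\<delta>. LINT t:{\<delta>..1 - \<delta>}|lborel. g t) \<longlongrightarrow> (LINT t:{0..1}|lborel. g t)) (at_right 0)"
proof -
  define F where "F x = integral {0..x} g" for x
  have int: "g integrable_on {0..1}"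
    by (rule set_borel_integral_eq_integral(1)[OF g])
  have F: "continuous_on {0..1} F"
    unfolding F_def by (rule indefinite_integral_continuous_1[OF int])
  \<comment> \<open>Below 1/2 the truncation points satisfy \<open>\<delta> < 1 - \<delta>\<close>
    and both lie in \<open>{0..1}\<close>.\<close>
  have small: "eventually (\<lambda>\<delta>::real. \<delta> \<in> {0<..<1/2}) (at_right 0)"
    by (rule eventually_at_right_real) simp
  have "((\<lambda>\<delta>. F (1 - \<delta>)) \<longlongrightarrow> F 1) (at_right 0)"
  proof (rule continuous_on_tendsto_compose[OF F])
    show "((\<lambda>\<delta>::real. 1 - \<delta>) \<longlongrightarrow> 1) (at_right 0)"
      by (auto intro!: tendsto_eq_intros)
  qed (use small in \<open>auto elim: eventually_mono\<close>)
  moreover have "((\<lambda>\<delta>. F \<delta>) \<longlongrightarrow> F 0) (at_right 0)"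
    by (rule continuous_on_tendsto_compose[OF F tendsto_ident_at])
       (use small in \<open>auto elim: eventually_mono\<close>)
  ultimately have "((\<lambda>\<delta>. F (1 - \<delta>) - F \<delta>) \<longlongrightarrow> F 1 - F 0) (at_right 0)"
    by (rule tendsto_diff)
  moreover have "F 1 - F 0 = (LINT t:{0..1}|lborel. g t)"
    by (simp add: F_def set_borel_integral_eq_integral(2)[OF g])
  moreover have "eventually (\<lambda>\<delta>. F (1 - \<delta>) - F \<delta> = (LINT t:{\<delta>..1 - \<delta>}|lborel. g t)) (at_right 0)"
    using small
  proof eventually_elim
    case (elim \<delta>)
    have "set_integrable lborel {\<delta>..1 - \<delta>} g"
      by (rule set_integrable_subset[OF g]) (use elim in auto)
    moreover have "F \<delta> + integral {\<delta>..1 - \<delta>} g = F (1 - \<delta>)"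
      unfolding F_def using elim
      by (intro Henstock_Kurzweil_Integration.integral_combine integrable_on_subinterval[OF int]) auto
    ultimately show ?case
      by (simp add: set_borel_integral_eq_integral(2))
  qed
  ultimately show ?thesis
    by (simp add: Lim_transform_eventually)
qed

section \<open>The kernel of the unit circle\<close>

abbreviation unit_circle :: "real \<Rightarrow> complex" where
  "unit_circle s \<equiv> exp (2 * of_real pi * \<i> * of_real s)"

text \<open>This is the integrand of the equation at \<open>s = 0\<close>, without the factor
  \<open>\<sigma>\<close>.\<close>

definition circle_kernel :: "real \<Rightarrow> real \<Rightarrow> complex" where
  "circle_kernel \<sigma> t = (1 - unit_circle t) / of_real (cmod (1 - unit_circle t) powr (2 + \<sigma>))"

lemma unit_circle_eq_cis: "unit_circle t = cis (2 * pi * t)"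
  by (simp add: cis_conv_exp mult_ac)

lemma unit_circle_reflect: "unit_circle (1 - t) = cnj (unit_circle t)"
  unfolding unit_circle_eq_cis by (simp add: complex_eq_iff right_diff_distrib cos_diff sin_diff)

lemma cmod_one_minus_unit_circle: "cmod (1 - unit_circle t) = 2 * \<bar>sin (pi * t)\<bar>"
  using dist_exp_i_1[of "2 * pi * t"] by (simp add: norm_minus_commute mult_ac)

text \<open>Reflection conjugates the numerator and keeps the denominator. The two numerators add up
  to the square of the chord length \<open>m\<close>, which cancels the 2 in the exponent.\<close>

lemma circle_kernel_add_reflect:
  assumes "0 < t" "t < 1"
  shows "circle_kernel \<sigma> t + circle_kernel \<sigma> (1 - t) = of_real (1 / (2 * sin (pi * t)) powr \<sigma>)"
proof -
  define m where "m = 2 * sin (pi * t)"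
  have "sin (pi * t) > 0"
    using assms by (intro sin_gt_zero) auto
  then have m: "m > 0" and norm: "cmod (1 - unit_circle t) = m"
    by (auto simp: m_def cmod_one_minus_unit_circle)
  have norm': "cmod (1 - cnj (unit_circle t)) = m"
    using norm by (metis complex_cnj_diff complex_cnj_one complex_mod_cnj)
  have "(1 - unit_circle t) + (1 - cnj (unit_circle t)) = of_real (m\<^sup>2)"
    unfolding unit_circle_eq_cis
    using cos_double_sin[of "pi * t"] by (simp add: complex_eq_iff m_def mult.assoc)
  then have "circle_kernel \<sigma> t + circle_kernel \<sigma> (1 - t) = of_real (m\<^sup>2 / m powr (2 + \<sigma>))"
    unfolding circle_kernel_def unit_circle_reflect norm norm'
    by (simp flip: add_divide_distrib)
  also have "m\<^sup>2 / m powr (2 + \<sigma>) = 1 / m powr \<sigma>"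
    using m by (simp add: powr_add)
  finally show ?thesis
    by (simp add: m_def)
qed

text \<open>Away from 0 and 1 the chord length is positive, so the kernel is continuous on a compact
  interval.\<close>

lemma set_integrable_circle_kernel:
  assumes "0 < a" "b < 1"
  shows "set_integrable lborel {a..b} (circle_kernel \<sigma>)"
  unfolding circle_kernel_def
proof (intro borel_integrable_atLeastAtMost' continuous_intros ballI)
  fix t assume "t \<in> {a..b}"
  then have "sin (pi * t) > 0"
    using assms by (intro sin_gt_zero) auto
  then have "cmod (1 - unit_circle t) > 0"
    by (simp add: cmod_one_minus_unit_circle)
  then show "cmod (1 - unit_circle t) \<noteq> 0" 
    "complex_of_real (cmod (1 - unit_circle t) powr (2 + \<sigma>)) \<noteq> 0"
    by auto
qed

lemma has_truncated_integral_circle_kernel: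
  assumes "0 < \<sigma>" "\<sigma> < 1"
  shows "has_truncated_integral (circle_kernel \<sigma>) 0 1
    (of_real ((LINT t:{0..1}|lborel. 1 / (2 * sin (pi * t)) powr \<sigma>) / 2))"
  unfolding has_truncated_integral_def
proof (intro conjI allI impI)
  let ?g = "\<lambda>t. 1 / (2 * sin (pi * t)) powr \<sigma>"
  show "set_integrable lborel {0 + \<delta>..1 - \<delta>} (circle_kernel \<sigma>)" if "\<delta> > 0" for \<delta>
    using that by (intro set_integrable_circle_kernel) auto
  have "(LINT t:{\<delta>..1 - \<delta>}|lborel. circle_kernel \<sigma> t) = of_real ((LINT t:{\<delta>..1 - \<delta>}|lborel. ?g t) / 2)"
    if "\<delta> > 0" for \<delta>
  proof -
    have int: "set_integrable lborel {\<delta>..1 - \<delta>} (circle_kernel \<sigma>)"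
      using that by (intro set_integrable_circle_kernel) auto
    \<comment> \<open>The reflected kernel has the same integral; truncation supplies the
      integrability needed to split the sum.\<close>
    have "2 * (LINT t:{\<delta>..1 - \<delta>}|lborel. circle_kernel \<sigma> t) =
        (LINT t:{\<delta>..1 - \<delta>}|lborel. circle_kernel \<sigma> t + circle_kernel \<sigma> (1 - t))"
      using int by (subst set_integral_add)
        (auto simp: set_integrable_reflect_unit set_integral_reflect_unit)
    also have "\<dots> = (LINT t:{\<delta>..1 - \<delta>}|lborel. of_real (?g t))"
      using that by (intro set_lebesgue_integral_cong) (auto simp: circle_kernel_add_reflect)
    also have "\<dots> = of_real (LINT t:{\<delta>..1 - \<delta>}|lborel. ?g t)"
      by (rule set_integral_complex_of_real)
    finally show ?thesis
      unfolding of_real_divide of_real_numeral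
      by (metis nonzero_mult_div_cancel_left zero_neq_numeral)
  qed
  then have "eventually (\<lambda>\<delta>. of_real ((LINT t:{\<delta>..1 - \<delta>}|lborel. ?g t) / 2) =
      (LINT t:{0 + \<delta>..1 - \<delta>}|lborel. circle_kernel \<sigma> t)) (at_right 0)"
    by (intro eventually_mono[OF eventually_at_right_less[of 0]]) simp
  moreover have "((\<lambda>\<delta>. complex_of_real ((LINT t:{\<delta>..1 - \<delta>}|lborel. ?g t) / 2)) \<longlongrightarrow>
      of_real ((LINT t:{0..1}|lborel. ?g t) / 2)) (at_right 0)"
    by (intro tendsto_of_real tendsto_divide tendsto_const set_integral_truncated_tendsto
        set_integrable_inverse_sin_powr assms) simp
  ultimately show "((\<lambda>\<delta>. LINT t:{0 + \<delta>..1 - \<delta>}|lborel. circle_kernel \<sigma> t) \<longlongrightarrow>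
      of_real ((LINT t:{0..1}|lborel. ?g t) / 2)) (at_right 0)"
    by (rule Lim_transform_eventually[rotated])
qed

text \<open>The common factor \<open>unit_circle s\<close> has modulus one and drops out of the
  denominator.\<close>

lemma unit_circle_kernel:
  "(unit_circle s - unit_circle r) / of_real (cmod (unit_circle s - unit_circle r) powr (2 + \<sigma>)) =
    unit_circle s * circle_kernel \<sigma> (r - s)"
proof -
  have "unit_circle s - unit_circle r = unit_circle s * (1 - unit_circle (r - s))"
    unfolding unit_circle_eq_cis by (simp add: right_diff_distrib cis_mult)
  then show ?thesis
    by (simp add: circle_kernel_def norm_mult unit_circle_eq_cis)
qed

section \<open>The equation of motion on the circle\<close>

lemma has_vector_derivative_unit_circle:
  "((\<lambda>s. c * unit_circle s) has_vector_derivative (2 * of_real pi * \<i> * c) * unit_circle s) (at s)"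
  by (auto intro!: derivative_eq_intros has_vector_derivative_real_field)

text \<open>Both sides of the equation are multiples of \<open>unit_circle s\<close>, which never
  vanishes. Cancelling it leaves one scalar condition that does not depend on
  \<open>s\<close>.\<close>

lemma is_solution_unit_circle_iff:
  assumes L: "has_truncated_integral (circle_kernel \<sigma>) 0 1 L"
  shows "is_solution \<sigma> v unit_circle \<longleftrightarrow> of_real (v\<^sup>2) = of_real (\<sigma> / (4 * pi\<^sup>2)) * L"
proof -
  let ?w = "2 * of_real pi * \<i> :: complex"
  have d1: "(unit_circle has_vector_derivative ?w * unit_circle s) (at s)" for s
    using has_vector_derivative_unit_circle[of 1 s] by simp
  have d2: "((\<lambda>s. ?w * unit_circle s) has_vector_derivative (?w * ?w) * unit_circle s) (at s)" for s
    by (rule has_vector_derivative_unit_circle)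
  have ti: "has_truncated_integral
      (\<lambda>r. of_real \<sigma> * ((unit_circle s - unit_circle r) /
        of_real (cmod (unit_circle s - unit_circle r) powr (2 + \<sigma>))))
      s (1 + s) (of_real \<sigma> * unit_circle s * L)" for s
    using has_truncated_integral_shift[OF L, of "of_real \<sigma> * unit_circle s" s]
    unfolding unit_circle_kernel by (simp add: mult.assoc)
  have eq: "of_real (v\<^sup>2) * ((?w * ?w) * unit_circle s) = - (of_real \<sigma> * unit_circle s * L) \<longleftrightarrow>
      of_real (v\<^sup>2) = of_real (\<sigma> / (4 * pi\<^sup>2)) * L" for s
  proof -
    \<comment> \<open>Here \<open>?w * ?w\<close> is the negative real number -4
      \<open>pi\<^sup>2\<close>, whose sign cancels the minus on the right.\<close>
    have "of_real (v\<^sup>2) * ((?w * ?w) * unit_circle s) = - (of_real \<sigma> * unit_circle s * L) \<longleftrightarrow>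
      unit_circle s * (of_real (v\<^sup>2) * (4 * of_real (pi\<^sup>2))) = unit_circle s * (of_real \<sigma> * L)"
      by (auto simp: power2_eq_square algebra_simps)
    also have "\<dots> \<longleftrightarrow> of_real (v\<^sup>2) * (4 * of_real (pi\<^sup>2)) = of_real \<sigma> * L"
      by (subst mult_cancel_left) simp
    also have "\<dots> \<longleftrightarrow> of_real (v\<^sup>2) = of_real (\<sigma> / (4 * pi\<^sup>2)) * L"
      by (auto simp: field_simps)
    finally show ?thesis .
  qed
  show ?thesis
  proof
    assume "is_solution \<sigma> v unit_circle"
    then obtain x1 x2 where x1: "\<And>s. (unit_circle has_vector_derivative x1 s) (at s)"
      and x2: "\<And>s. (x1 has_vector_derivative x2 s) (at s)"
      and sol: "\<And>s. \<exists>L. has_truncated_integral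
         (\<lambda>r. of_real \<sigma> * ((unit_circle s - unit_circle r) /
           of_real (cmod (unit_circle s - unit_circle r) powr (2 + \<sigma>)))) s (1 + s) L \<and>
         of_real (v\<^sup>2) * x2 s = - L"
      unfolding is_solution_def by blast
    \<comment> \<open>Derivatives are unique, so the given witnesses agree with the explicit ones.
      As \<open>eq\<close> yields the same condition for every \<open>s\<close>, evaluation at 0
      suffices.\<close>
    have "x1 = (\<lambda>s. ?w * unit_circle s)"
      using vector_derivative_unique_at[OF x1 d1] by blast
    then have "x2 0 = (?w * ?w) * unit_circle 0"
      using vector_derivative_unique_at[OF x2 [of 0]] d2[of 0] by metis
    moreover have "of_real (v\<^sup>2) * x2 0 = - (of_real \<sigma> * unit_circle 0 * L)"
    proof -
      from sol[of 0] obtain M where M: "has_truncated_integral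
         (\<lambda>r. of_real \<sigma> * ((unit_circle 0 - unit_circle r) /
           of_real (cmod (unit_circle 0 - unit_circle r) powr (2 + \<sigma>)))) 0 (1 + 0) M"
        "of_real (v\<^sup>2) * x2 0 = - M"
        by blast
      show ?thesis
        unfolding M(2) has_truncated_integral_unique[OF M(1) ti[of 0]] by (rule refl)
    qed
    ultimately show "of_real (v\<^sup>2) = of_real (\<sigma> / (4 * pi\<^sup>2)) * L"
      unfolding eq[of 0, symmetric] by (simp only:)
  next
    assume "of_real (v\<^sup>2) = of_real (\<sigma> / (4 * pi\<^sup>2)) * L"
    then show "is_solution \<sigma> v unit_circle"
      unfolding is_solution_def
      by (intro exI conjI allI) (rule d1 d2 ti iffD2[OF eq] | assumption)+
  qed
qed

text \<open>A single \<open>L\<close> serves as the limit in both equalities. Integrability of the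
  sine power is asserted separately because \<open>LINT\<close> defaults to 0 on non-integrable
  functions.\<close>

theorem proposition3p1:
  fixes \<sigma> v :: real
  assumes "0 < \<sigma>" and "\<sigma> < 1"
  shows "\<exists>L :: complex.
    has_truncated_integral
      (\<lambda>t. (1 - exp (2 * of_real pi * \<i> * of_real t)) /
           of_real (cmod (1 - exp (2 * of_real pi * \<i> * of_real t)) powr (2 + \<sigma>)))
      0 1 L \<and>
    set_integrable lborel {0..1} (\<lambda>t. 1 / (2 * sin (pi * t)) powr \<sigma>) \<and>
    of_real (\<sigma> / (4 * pi\<^sup>2)) * L =
      of_real (\<sigma> / (8 * pi\<^sup>2) * (LINT t:{0..1}|lborel. 1 / (2 * sin (pi * t)) powr \<sigma>)) \<and>
    (is_solution \<sigma> v (\<lambda>s. exp (2 * of_real pi * \<i> * of_real s)) \<longleftrightarrow>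
      of_real (v\<^sup>2) = of_real (\<sigma> / (4 * pi\<^sup>2)) * L)"
proof (intro exI conjI)
  note L = has_truncated_integral_circle_kernel[OF assms]
  \<comment> \<open>The witness is still schematic; this goal fixes it as half of the sine integral,
    which turns the constant 4 into 8.\<close>
  then show "has_truncated_integral
      (\<lambda>t. (1 - exp (2 * of_real pi * \<i> * of_real t)) /
           of_real (cmod (1 - exp (2 * of_real pi * \<i> * of_real t)) powr (2 + \<sigma>))) 0 1
      (of_real ((LINT t:{0..1}|lborel. 1 / (2 * sin (pi * t)) powr \<sigma>) / 2))"
    by (simp add: circle_kernel_def[abs_def])
  show "is_solution \<sigma> v unit_circle \<longleftrightarrow> of_real (v\<^sup>2) = of_real (\<sigma> / (4 * pi\<^sup>2)) *
      complex_of_real ((LINT t:{0..1}|lborel. 1 / (2 * sin (pi * t)) powr \<sigma>) / 2)"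
    by (rule is_solution_unit_circle_iff[OF L])
qed (simp_all add: set_integrable_inverse_sin_powr[OF assms])

end
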